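(* Let $(X,X_+,\mathcal{K},f)$ be an abstract state space and let $\{T_n\}_{n\ge1}$ be a sequence of Markov operators on $X$, the generating sequence of the NDMC $\{T^{m,n}\}$. Let $\{P_n\}_{n\ge1}$ be a left decreasing sequence of projections of $X$ such that $T_nP_n=P_nT_n=P_n$ for all $n\in\mathbb{N}$, and $P_n\to P$ in norm. If there exists a constant $C>0$ with $$\sum_{l=1}^{n-1}\delta_P(T^{l,n})\le C\qquad\text{for all } n\in\mathbb{N},$$ then $\{T^{k,n}\}$ is uniformly $P$-ergodic.
   Context: Abstract state space: $X$ is a real ordered vector space with generating cone $X_+=\{x\in X: x\ge 0\}$ (i.e. $X=X_+-X_+$), $f$ is a strictly positive linear functional on $X$ ($f(x)>0$ for $x>0$), and $\mathcal{K}=\{x\in X_+: f(x)=1\}$. With $U$ the convex hull of $\mathcal{K}\cup(-\mathcal{K})$, put $\|x\|=\inf\{\lambda\in\mathbb{R}_+: x\in\lambda U\}$. $(X,X_+,\mathcal{K},f)$ is an abstract state space if $\|\cdot\|$ is a norm, $X$ is complete for it, and $X_+$ is closed. $X$ always carries this norm, and norms of operators are the induced operator norms. Markov operator: a linear $T:X\to X$ that is positive and satisfies $T(\mathcal{K})\subset\mathcal{K}$ (then $\|T\|=1$). Projection: a bounded linear $P:X\to X$ with $P^2=P$. $\mathbb{N}=\{1,2,\dots\}$. The nonhomogeneous discrete Markov chain (NDMC) generated by $\{T_n\}_{n\ge1}$ is the family $T^{k,n}=T_nT_{n-1}\cdots T_{k+1}$, $0\le k<n$. A sequence of projections $\{P_n\}$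 is left decreasing if $P_{n+1}P_n=P_{n+1}$ for all $n\in\mathbb{N}$. Generalized Dobrushin coefficient: for a projection $P\neq I$, $N_P=\{x\in X: Px=0\}$ and $\delta_P(T)=\sup_{x\in N_P,\,x\ne0}\|Tx\|/\|x\|$ for bounded linear $T$; by convention $\delta_I(T)=1$. $\{T^{k,n}\}$ is uniformly $P$-ergodic if $\lim_{n\to\infty}\|T^{m,n}-P\|=0$ for every $m\ge0$. *)

theory Defs
  imports "HOL-Analysis.Analysis"
begin

definition base :: "('a::ordered_real_vector \<Rightarrow> real) \<Rightarrow> 'a set" where
  "base f = {x. 0 \<le> x \<and> f x = 1}"

definition base_ball :: "('a::ordered_real_vector \<Rightarrow> real) \<Rightarrow> 'a set" where
  "base_ball f = convex hull (base f \<union> uminus ` base f)"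

text \<open>The positive cone is given by the order of the type. That the Minkowski gauge of
  \<^term>\<open>base_ball f\<close> is a complete norm is expressed by the class \<^class>\<open>banach\<close> together with
  the equation \<open>norm_eq\<close>; all topological notions and operator norms therefore refer to
  the gauge norm.\<close>

locale abstract_state_space =
  fixes f :: "'a::{ordered_real_vector, banach} \<Rightarrow> real"
  assumes generating: "\<exists>y z. 0 \<le> y \<and> 0 \<le> z \<and> x = y - z"
    and linear_f: "linear f"
    and strictly_positive: "0 < x \<Longrightarrow> 0 < f x"
    and norm_eq: "norm x = Inf {l. 0 \<le> l \<and> x \<in> (*\<^sub>R) l ` base_ball f}"
    and closed_cone: "closed {x::'a. 0 \<le> x}"

definition markov_operator ::
    "('a::ordered_real_vector \<Rightarrow> real) \<Rightarrow> ('a \<Rightarrow> 'a) \<Rightarrow> bool" where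
  "markov_operator f T \<longleftrightarrow> linear T \<and> (\<forall>x\<ge>0. 0 \<le> T x) \<and> T ` base f \<subseteq> base f"

definition projection :: "('a::real_normed_vector \<Rightarrow> 'a) \<Rightarrow> bool" where
  "projection P \<longleftrightarrow> bounded_linear P \<and> P \<circ> P = P"

definition left_decreasing :: "(nat \<Rightarrow> 'a::real_normed_vector \<Rightarrow> 'a) \<Rightarrow> bool" where
  "left_decreasing P \<longleftrightarrow> (\<forall>n\<ge>1. P (n + 1) \<circ> P n = P (n + 1))"

text \<open>The product \<open>T n \<circ> T (n - 1) \<circ> \<dots> \<circ> T (k + 1)\<close>, which is \<^const>\<open>id\<close> when \<open>n \<le> k\<close>.\<close>

definition ndmc :: "(nat \<Rightarrow> 'a \<Rightarrow> 'a) \<Rightarrow> nat \<Rightarrow> nat \<Rightarrow> 'a \<Rightarrow> 'a" where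
  "ndmc T k n = fold (\<lambda>i S. T i \<circ> S) [k + 1..<n + 1] id"

definition dobrushin ::
    "('a::real_normed_vector \<Rightarrow> 'a) \<Rightarrow> ('a \<Rightarrow> 'a) \<Rightarrow> real" where
  "dobrushin P T =
     (if P = id then 1 else Sup {norm (T x) / norm x | x. P x = 0 \<and> x \<noteq> 0})"

definition uniformly_ergodic ::
    "(nat \<Rightarrow> 'a::real_normed_vector \<Rightarrow> 'a) \<Rightarrow> ('a \<Rightarrow> 'a) \<Rightarrow> bool" where
  "uniformly_ergodic T P \<longleftrightarrow>
     (\<forall>m. (\<lambda>n. onorm (\<lambda>x. ndmc T m n x - P x)) \<longlonglongrightarrow> 0)"

end

theory Submission imports Defs
begin

text \<open>
  Passing to the limit in \<open>P\<^sub>m P\<^sub>n = P\<^sub>m\<close> (\<open>m \<ge> n\<close>) gives \<open>P P\<^sub>n = P\<close> and \<open>P\<^sup>2 = P\<close>, and then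
  \<open>P T\<^sub>n = P P\<^sub>n T\<^sub>n = P P\<^sub>n = P\<close>. So every \<open>T\<^sub>n\<close> leaves the kernel of \<open>P\<close> invariant, and on this
  kernel \<open>T\<^sup>m\<^sup>,\<^sup>n\<close> acts with norm \<open>\<delta>\<^sub>P(T\<^sup>m\<^sup>,\<^sup>n)\<close>. In the splitting
  \[ T^{m,n} - P = T^{m,n}(I - P) + (T^{m,n}P - P) \]
  the first summand has norm at most \<open>\<delta>\<^sub>P(T\<^sup>m\<^sup>,\<^sup>n) \<parallel>I - P\<parallel>\<close>. Since Markov operators are contractions,
  \<open>\<delta>\<^sub>P(T\<^sup>m\<^sup>,\<^sup>n)\<close> is a lower bound of all the coefficients \<open>\<delta>\<^sub>P(T\<^sup>l\<^sup>,\<^sup>n)\<close> with \<open>m < l < n\<close>, so the bound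
  \<open>C\<close> on their sum makes it at most \<open>C/(n - 1 - m)\<close>.

  The second summand telescopes into
  \[ T^{m,n}P - P = \sum_{l=m+1}^{n} T^{l,n}(T_l P - P), \]
  where each defect \<open>T\<^sub>l P - P = (T\<^sub>l - I)(P - P\<^sub>l)\<close> takes values in the kernel of \<open>P\<close> and has norm
  at most \<open>2 \<parallel>P\<^sub>l - P\<parallel>\<close>, which tends to zero. Thus the second summand is dominated by sums
  \<open>\<Sum> \<delta>\<^sub>P(T\<^sup>l\<^sup>,\<^sup>n) e\<^sub>l\<close> of a null sequence against weights of bounded mass that vanish as \<open>n\<close> grows
  with \<open>l\<close> fixed; these tend to zero by Toeplitz' lemma (\<open>toeplitz_null_sequence\<close>).
\<close>

section \<open>Markov operators are contractions\<close>

text \<open>The generating cone makes \<^term>\<open>base_ball f\<close> absorbing: write \<open>x = y - z\<close> with positive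
  \<open>y\<close>, \<open>z\<close>, and normalise both by \<open>f\<close>. Thus the infimum in the norm is over a nonempty set.
  The zero vector is excluded because in the trivial space the base ball is empty.\<close>

lemma (in abstract_state_space) base_ball_absorbing:
  assumes "x \<noteq> 0"
  shows "\<exists>l>0. x \<in> (*\<^sub>R) l ` base_ball f"
proof -
  interpret linear f by (rule linear_f)
  obtain y z where yz: "0 \<le> y" "0 \<le> z" "x = y - z"
    using generating[of x] by blast
  have normalise: "\<exists>k \<in> base f. u = f u *\<^sub>R k" "0 < f u" if "0 \<le> u" "u \<noteq> 0" for u
  proof -
    show pos: "0 < f u" using that strictly_positive[of u] by simp
    have "inverse (f u) *\<^sub>R u \<in> base f"
      using pos that by (simp add: base_def scale scaleR_nonneg_nonneg)
    moreover have "u = f u *\<^sub>R (inverse (f u) *\<^sub>R u)" using pos by simp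
    ultimately show "\<exists>k \<in> base f. u = f u *\<^sub>R k" by blast
  qed
  have in_ball: "k \<in> base_ball f" "- k \<in> base_ball f" if "k \<in> base f" for k
    using that by (auto simp: base_ball_def intro!: hull_inc)
  consider "y = 0" | "z = 0" | "y \<noteq> 0" "z \<noteq> 0" by blast
  then show ?thesis
  proof cases
    case 1
    then have "z \<noteq> 0" using assms yz by auto
    then obtain k where "k \<in> base f" "z = f z *\<^sub>R k" "0 < f z"
      using normalise yz(2) by blast
    then have "x = f z *\<^sub>R (- k)" using 1 yz(3) by (metis diff_0 scaleR_minus_right)
    then show ?thesis using in_ball(2) \<open>k \<in> base f\<close> \<open>0 < f z\<close> by blast
  next
    case 2
    then have "y \<noteq> 0" using assms yz by auto
    then obtain k where "k \<in> base f" "y = f y *\<^sub>R k" "0 < f y"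
      using normalise yz(1) by blast
    then have "x = f y *\<^sub>R k" using 2 yz(3) by simp
    then show ?thesis using in_ball(1) \<open>k \<in> base f\<close> \<open>0 < f y\<close> by blast
  next
    case 3
    obtain k where k: "k \<in> base f" "y = f y *\<^sub>R k" "0 < f y"
      using normalise yz(1) 3(1) by blast
    obtain k' where k': "k' \<in> base f" "z = f z *\<^sub>R k'" "0 < f z"
      using normalise yz(2) 3(2) by blast
    define l where "l = f y + f z"
    have l: "l > 0" using k k' by (simp add: l_def)
    have "convex (base_ball f)" by (simp add: base_ball_def)
    then have "(f y / l) *\<^sub>R k + (f z / l) *\<^sub>R (- k') \<in> base_ball f"
    proof (rule convexD)
      show "f y / l + f z / l = 1" using l by (simp add: l_def flip: add_divide_distrib)
    qed (use in_ball k k' l in auto)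
    moreover have "x = l *\<^sub>R ((f y / l) *\<^sub>R k + (f z / l) *\<^sub>R (- k'))"
    proof -
      have "l *\<^sub>R ((f y / l) *\<^sub>R k + (f z / l) *\<^sub>R (- k')) = f y *\<^sub>R k - f z *\<^sub>R k'"
        using l by (simp add: scaleR_right_distrib scaleR_right_diff_distrib)
      then show ?thesis using k(2) k'(2) yz(3) by simp
    qed
    ultimately show ?thesis using l by blast
  qed
qed

text \<open>A linear map that preserves the base also preserves the convex hull of the base and its
  negative, so every dilate of that hull that contains \<open>x\<close> also contains \<open>T x\<close>.\<close>

lemma (in abstract_state_space) markov_operator_contraction:
  assumes "markov_operator f T"
  shows "norm (T x) \<le> norm x"
proof (cases "x = 0")
  case True
  then show ?thesis using assms by (simp add: markov_operator_def linear_0)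
next
  case False
  interpret T: linear T using assms by (simp add: markov_operator_def)
  have "T ` (base f \<union> uminus ` base f) \<subseteq> base f \<union> uminus ` base f"
    using assms by (auto simp: markov_operator_def T.neg)
  then have ball: "T ` base_ball f \<subseteq> base_ball f"
    unfolding base_ball_def convex_hull_linear_image[OF T.linear_axioms] by (rule hull_mono)
  have "{l. 0 \<le> l \<and> x \<in> (*\<^sub>R) l ` base_ball f} \<subseteq> {l. 0 \<le> l \<and> T x \<in> (*\<^sub>R) l ` base_ball f}"
    using ball by (auto simp: T.scale intro!: imageI)
  moreover have "{l. 0 \<le> l \<and> x \<in> (*\<^sub>R) l ` base_ball f} \<noteq> {}"
    using base_ball_absorbing[OF False] less_imp_le by blast
  moreover have "bdd_below {l. 0 \<le> l \<and> T x \<in> (*\<^sub>R) l ` base_ball f}"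
    by (rule bdd_belowI[of _ 0]) simp
  ultimately show ?thesis
    unfolding norm_eq[of x] norm_eq[of "T x"] by (intro cInf_superset_mono)
qed

section \<open>The Dobrushin coefficient\<close>

text \<open>Contractivity of \<open>S\<close> keeps the supremum bounded. For \<open>P = id\<close> the kernel is trivial, so the
  conventional value of the coefficient does no harm.\<close>

lemma norm_le_dobrushin:
  assumes contr: "\<And>x. norm (S x) \<le> norm x" and "P x = 0"
  shows "norm (S x) \<le> dobrushin P S * norm x"
proof (cases "x = 0")
  case True
  then show ?thesis using contr[of 0] by simp
next
  case False
  then have "P \<noteq> id" using assms(2) by auto
  have "bdd_above {norm (S x) / norm x | x. P x = 0 \<and> x \<noteq> 0}"
    by (rule bdd_aboveI[of _ 1]) (use contr in \<open>auto simp: divide_le_eq_1\<close>)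
  then have "norm (S x) / norm x \<le> dobrushin P S"
    unfolding dobrushin_def using \<open>P \<noteq> id\<close> False assms(2) by (auto intro!: cSup_upper)
  then show ?thesis using False by (simp add: field_simps)
qed

lemma idempotent_kernel_nontrivial:
  assumes "linear P" "\<And>x. P (P x) = P x" "P \<noteq> id"
  obtains x where "P x = 0" "x \<noteq> 0"
proof -
  obtain y where "P y \<noteq> y" using assms(3) by (auto simp: fun_eq_iff)
  then show ?thesis using that[of "y - P y"] assms(1,2) by (auto simp: linear_diff)
qed

lemma dobrushin_le:
  assumes "linear P" "\<And>x. P (P x) = P x" "P \<noteq> id"
    and "\<And>x. P x = 0 \<Longrightarrow> norm (S x) \<le> c * norm x"
  shows "dobrushin P S \<le> c"
proof -
  obtain x where "P x = 0" "x \<noteq> 0" using idempotent_kernel_nontrivial assms(1-3) by blast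
  then show ?thesis
    unfolding dobrushin_def using assms(3,4)
    by (auto intro!: cSup_least simp: divide_le_eq)
qed

lemma dobrushin_nonneg:
  assumes "linear P" "\<And>x. P (P x) = P x" "P \<noteq> id"
    and contr: "\<And>x. norm (S x) \<le> norm x"
  shows "0 \<le> dobrushin P S"
proof -
  obtain x where x: "P x = 0" "x \<noteq> 0" using idempotent_kernel_nontrivial assms(1-3) by blast
  have "0 \<le> dobrushin P S * norm x"
    using norm_le_dobrushin[of S P x, OF contr x(1)] norm_ge_zero[of "S x"] by linarith
  then show ?thesis using x(2) by (simp add: zero_le_mult_iff)
qed

section \<open>Weighted sums of null sequences\<close>

text \<open>This is Toeplitz' lemma for a null sequence: the weights of each fixed initial segment vanish,
  and the rest of the sum is at most \<open>C\<close> times a small bound on the tail of \<open>e\<close>.\<close>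

lemma toeplitz_null_sequence:
  fixes d :: "nat \<Rightarrow> nat \<Rightarrow> real"
  assumes d0: "\<And>l n. 0 \<le> d l n" and e0: "\<And>l. 0 \<le> e l"
    and d: "\<And>l. (\<lambda>n. d l n) \<longlonglongrightarrow> 0" and e: "e \<longlonglongrightarrow> 0"
    and C: "C > 0" "\<And>n. n \<ge> 1 \<Longrightarrow> (\<Sum>l = 1..n - 1. d l n) \<le> C"
  shows "(\<lambda>n. \<Sum>l = 1..n - 1. d l n * e l) \<longlonglongrightarrow> 0"
proof (rule LIMSEQ_I)
  fix r :: real assume r: "0 < r"
  define s where "s = r / (2 * C)"
  have s: "0 < s" "C * s = r / 2" using r C by (auto simp: s_def)
  obtain L where L: "\<And>l. l \<ge> L \<Longrightarrow> e l < s"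
    using order_tendstoD(2)[OF e s(1)] by (auto simp: eventually_sequentially)
  have "(\<lambda>n. \<Sum>l<L. d l n * e l) \<longlonglongrightarrow> 0"
    by (intro tendsto_null_sum tendsto_mult_left_zero d)
  then obtain M where M: "\<And>n. n \<ge> M \<Longrightarrow> (\<Sum>l<L. d l n * e l) < r / 2"
    using order_tendstoD(2)[of _ 0 sequentially "r / 2"] r by (auto simp: eventually_sequentially)
  show "\<exists>no. \<forall>n\<ge>no. norm ((\<Sum>l = 1..n - 1. d l n * e l) - 0) < r"
  proof (intro exI allI impI)
    fix n assume n: "n \<ge> max 1 M"
    let ?A = "{1..n - 1}"
    have "(\<Sum>l\<in>?A. d l n * e l) \<le> (\<Sum>l\<in>?A. (if l < L then d l n * e l else 0) + d l n * s)"
      using L d0 s(1) by (intro sum_mono) (auto intro!: mult_left_mono simp: less_imp_le)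
    also have "\<dots> = (\<Sum>l\<in>{l\<in>?A. l < L}. d l n * e l) + (\<Sum>l\<in>?A. d l n) * s"
      by (simp add: sum.distrib sum_distrib_right flip: sum.inter_filter)
    also have "(\<Sum>l\<in>{l\<in>?A. l < L}. d l n * e l) \<le> (\<Sum>l<L. d l n * e l)"
      using d0 e0 by (intro sum_mono2) auto
    also have "(\<Sum>l<L. d l n * e l) < r / 2" using M n by simp
    also have "(\<Sum>l\<in>?A. d l n) * s \<le> r / 2"
      using C(2)[of n] n s by (metis max.bounded_iff less_imp_le mult_right_mono)
    finally have "(\<Sum>l\<in>?A. d l n * e l) < r" by simp
    moreover have "0 \<le> (\<Sum>l\<in>?A. d l n * e l)" using d0 e0 by (intro sum_nonneg) simp
    ultimately show "norm ((\<Sum>l\<in>?A. d l n * e l) - 0) < r" by simp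
  qed
qed

section \<open>Chains of contractions that preserve a projection\<close>

lemma ndmc_refl [simp]: "ndmc T k k = id"
  by (simp add: ndmc_def)

lemma ndmc_Suc: "k \<le> n \<Longrightarrow> ndmc T k (Suc n) = T (Suc n) \<circ> ndmc T k n"
  by (simp add: ndmc_def)

lemma ndmc_trans:
  assumes "m \<le> l" "l \<le> n"
  shows "ndmc T l n \<circ> ndmc T m l = ndmc T m n"
  using assms(2)
proof (induction n rule: dec_induct)
  case (step k)
  then have "T (Suc k) \<circ> (ndmc T l k \<circ> ndmc T m l) = T (Suc k) \<circ> ndmc T m k"
    by (simp only:)
  then show ?case using step.hyps assms(1) by (simp only: ndmc_Suc comp_assoc le_trans)
qed simp

locale contraction_chain =
  fixes T :: "nat \<Rightarrow> 'a::real_normed_vector \<Rightarrow> 'a" and P :: "'a \<Rightarrow> 'a"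
  assumes linear_T: "n \<ge> 1 \<Longrightarrow> linear (T n)"
    and contraction_T: "n \<ge> 1 \<Longrightarrow> norm (T n x) \<le> norm x"
    and bounded_linear_P: "bounded_linear P"
    and idempotent_P: "P (P x) = P x"
    and P_T: "n \<ge> 1 \<Longrightarrow> P (T n x) = P x"
begin

lemma linear_P: "linear P"
  using bounded_linear_P by (rule bounded_linear.linear)

lemma ndmc_induct:
  assumes "Q id" "\<And>n S. n \<ge> 1 \<Longrightarrow> Q S \<Longrightarrow> Q (T n \<circ> S)"
  shows "Q (ndmc T k n)"
proof (cases "k \<le> n")
  case True
  then show ?thesis
  proof (induction n rule: dec_induct)
    case base
    show ?case by (simp only: ndmc_refl assms(1))
  next
    case (step n)
    then show ?case using assms(2)[of "Suc n"] by (simp only: ndmc_Suc)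
  qed
next
  case False
  then show ?thesis using assms(1) by (simp only: ndmc_def) simp
qed

lemma linear_ndmc: "linear (ndmc T k n)"
  by (rule ndmc_induct) (intro linear_id linear_compose linear_T)+

lemma contraction_ndmc: "norm (ndmc T k n x) \<le> norm x"
  by (rule ndmc_induct[where Q = "\<lambda>S. norm (S x) \<le> norm x"])
    (auto intro: order_trans[OF contraction_T])

lemma P_ndmc: "P (ndmc T k n x) = P x"
  by (rule ndmc_induct[where Q = "\<lambda>S. P (S x) = P x"]) (simp_all add: P_T)

abbreviation coeff :: "nat \<Rightarrow> nat \<Rightarrow> real" where
  "coeff l n \<equiv> dobrushin P (ndmc T l n)"

lemma coeff_nonneg: "P \<noteq> id \<Longrightarrow> 0 \<le> coeff l n"
  by (intro dobrushin_nonneg linear_P idempotent_P contraction_ndmc)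

text \<open>A longer chain has the smaller coefficient: its first factors are contractions that map the
  kernel of \<open>P\<close> into itself.\<close>

lemma coeff_mono:
  assumes "P \<noteq> id" "m \<le> l" "l \<le> n"
  shows "coeff m n \<le> coeff l n"
proof (rule dobrushin_le[OF linear_P idempotent_P assms(1)])
  fix x assume "P x = 0"
  have "ndmc T m n x = ndmc T l n (ndmc T m l x)"
    using ndmc_trans[OF assms(2,3), of T] by (metis comp_apply)
  also have "norm \<dots> \<le> coeff l n * norm (ndmc T m l x)"
    by (rule norm_le_dobrushin) (simp_all add: contraction_ndmc P_ndmc \<open>P x = 0\<close>)
  also have "\<dots> \<le> coeff l n * norm x"
    using contraction_ndmc coeff_nonneg[OF assms(1)] by (intro mult_left_mono)
  finally show "norm (ndmc T m n x) \<le> coeff l n * norm x" .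
qed

text \<open>With \<open>P = id\<close> every coefficient is \<open>1\<close> by convention, so the sums are unbounded.\<close>

lemma not_id_if_coeff_sum_bounded:
  assumes "\<And>n. n \<ge> 1 \<Longrightarrow> (\<Sum>l = 1..n - 1. coeff l n) \<le> C"
  shows "P \<noteq> id"
proof
  assume "P = id"
  then have "real n \<le> C" for n
    using assms[of "Suc n"] by (simp add: dobrushin_def)
  then show False by (meson not_le reals_Archimedean2)
qed

lemma coeff_tendsto_0:
  assumes C: "\<And>n. n \<ge> 1 \<Longrightarrow> (\<Sum>l = 1..n - 1. coeff l n) \<le> C"
  shows "(\<lambda>n. coeff m n) \<longlonglongrightarrow> 0"
proof -
  have P: "P \<noteq> id" using not_id_if_coeff_sum_bounded C .
  have bound: "coeff m (n + (m + 2)) \<le> C * inverse (real (Suc n))" for n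
  proof -
    let ?N = "n + (m + 2)"
    \<comment> \<open>\<open>Suc n\<close> indices lie strictly between \<open>m\<close> and \<open>n + (m + 2)\<close>.\<close>
    have "real (Suc n) * coeff m ?N = (\<Sum>l = m + 1..?N - 1. coeff m ?N)" by simp
    also have "\<dots> \<le> (\<Sum>l = m + 1..?N - 1. coeff l ?N)"
      using P by (intro sum_mono coeff_mono) auto
    also have "\<dots> \<le> (\<Sum>l = 1..?N - 1. coeff l ?N)"
      using P by (intro sum_mono2) (auto intro: coeff_nonneg)
    also have "\<dots> \<le> C" by (rule C) simp
    finally show ?thesis by (simp add: field_simps)
  qed
  have "(\<lambda>n. coeff m (n + (m + 2))) \<longlonglongrightarrow> 0"
  proof (rule tendsto_sandwich[OF _ _ tendsto_const])
    show "(\<lambda>n. C * inverse (real (Suc n))) \<longlonglongrightarrow> 0"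
      by (rule tendsto_mult_right_zero[OF LIMSEQ_inverse_real_of_nat])
  qed (use bound coeff_nonneg[OF P] in auto)
  then show ?thesis by (rule LIMSEQ_offset)
qed

lemma ndmc_telescope:
  assumes "m \<le> n"
  shows "ndmc T m n x - x = (\<Sum>l\<in>{m<..n}. ndmc T l n (T l x - x))"
  using assms
proof (induction n rule: dec_induct)
  case (step k)
  interpret T: linear "T (Suc k)" by (rule linear_T) simp
  have "{m<..Suc k} = insert (Suc k) {m<..k}" using step by auto
  then have "(\<Sum>l\<in>{m<..Suc k}. ndmc T l (Suc k) (T l x - x))
      = T (Suc k) x - x + (\<Sum>l\<in>{m<..k}. T (Suc k) (ndmc T l k (T l x - x)))"
    by (simp add: ndmc_Suc)
  also have "\<dots> = T (Suc k) x - x + T (Suc k) (ndmc T m k x - x)"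
    by (simp only: step.IH T.sum)
  also have "\<dots> = ndmc T m (Suc k) x - x"
    using step.hyps by (simp add: ndmc_Suc T.diff)
  finally show ?case by simp
qed simp

text \<open>The last term of the telescoping sum is kept apart: the assumed bound on the sum of the
  coefficients stops at \<open>l = n - 1\<close>.\<close>

lemma ndmc_P_diff_bound:
  assumes P: "P \<noteq> id" and "m < n"
    and e0: "\<And>l. 0 \<le> e l"
    and defect: "\<And>l x. l \<ge> 1 \<Longrightarrow> norm (T l (P x) - P x) \<le> e l * norm x"
  shows "norm (ndmc T m n (P x) - P x) \<le> ((\<Sum>l = 1..n - 1. coeff l n * e l) + e n) * norm x"
proof -
  have factor: "norm (ndmc T l n (T l (P x) - P x)) \<le> coeff l n * e l * norm x" if "l \<ge> 1" for l
  proof -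
    have "P (T l (P x) - P x) = 0"
      using P_T[OF that] by (simp add: linear_diff linear_P)
    then have "norm (ndmc T l n (T l (P x) - P x)) \<le> coeff l n * norm (T l (P x) - P x)"
      by (intro norm_le_dobrushin contraction_ndmc)
    also have "\<dots> \<le> coeff l n * (e l * norm x)"
      using defect[OF that] coeff_nonneg[OF P] by (intro mult_left_mono)
    finally show ?thesis by (simp add: mult.assoc)
  qed
  have "{m<..n} = insert n {m<..<n}" using \<open>m < n\<close> by auto
  then have "ndmc T m n (P x) - P x
      = T n (P x) - P x + (\<Sum>l\<in>{m<..<n}. ndmc T l n (T l (P x) - P x))"
    using ndmc_telescope[of m n "P x"] \<open>m < n\<close> by simp
  also have "norm \<dots> \<le> e n * norm x + (\<Sum>l\<in>{m<..<n}. coeff l n * e l * norm x)"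
    using defect[of n] \<open>m < n\<close> factor by (intro norm_triangle_mono sum_norm_le) auto
  also have "(\<Sum>l\<in>{m<..<n}. coeff l n * e l * norm x) \<le> (\<Sum>l = 1..n - 1. coeff l n * e l * norm x)"
    using coeff_nonneg[OF P] e0 by (intro sum_mono2) auto
  finally show ?thesis by (simp add: sum_distrib_right distrib_right)
qed

text \<open>Both summands of \<open>T\<^sup>m\<^sup>,\<^sup>n - P = T\<^sup>m\<^sup>,\<^sup>n(I - P) + (T\<^sup>m\<^sup>,\<^sup>nP - P)\<close> tend to zero: the first with the
  coefficient, the second by Toeplitz' lemma. In the application \<open>e l\<close> is twice the distance from
  \<open>P\<close> to the projection fixed by \<open>T l\<close>.\<close>

theorem uniformly_ergodic_if_coeff_sum_bounded:
  assumes C: "C > 0" "\<And>n. n \<ge> 1 \<Longrightarrow> (\<Sum>l = 1..n - 1. coeff l n) \<le> C"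
    and e: "\<And>l. 0 \<le> e l" "e \<longlonglongrightarrow> 0"
    and defect: "\<And>l x. l \<ge> 1 \<Longrightarrow> norm (T l (P x) - P x) \<le> e l * norm x"
  shows "uniformly_ergodic T P"
  unfolding uniformly_ergodic_def
proof
  fix m
  have P: "P \<noteq> id" using not_id_if_coeff_sum_bounded C(2) .
  define K where "K = onorm (\<lambda>x. x - P x)"
  define b where "b n = coeff m n * K + ((\<Sum>l = 1..n - 1. coeff l n * e l) + e n)" for n
  have bl: "bounded_linear (\<lambda>x. x - P x)"
    by (intro bounded_linear_sub bounded_linear_ident bounded_linear_P)
  have "(\<lambda>n. \<Sum>l = 1..n - 1. coeff l n * e l) \<longlonglongrightarrow> 0"
    by (rule toeplitz_null_sequence[OF coeff_nonneg[OF P] e(1) coeff_tendsto_0[OF C(2)] e(2) C])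
  then have b_lim: "b \<longlonglongrightarrow> 0"
    unfolding b_def
    by (intro tendsto_add_zero tendsto_mult_left_zero coeff_tendsto_0[OF C(2)] e(2))
  have "onorm (\<lambda>x. ndmc T m n x - P x) \<le> b n" if "n > m" for n
  proof (rule onorm_bound)
    show "0 \<le> b n"
      unfolding b_def K_def using coeff_nonneg[OF P] e(1) onorm_pos_le[OF bl]
      by (intro add_nonneg_nonneg mult_nonneg_nonneg sum_nonneg) auto
    fix x
    have "norm (ndmc T m n (x - P x)) \<le> coeff m n * norm (x - P x)"
      by (intro norm_le_dobrushin contraction_ndmc) (simp add: linear_diff linear_P idempotent_P)
    also have "\<dots> \<le> coeff m n * (K * norm x)"
      using coeff_nonneg[OF P] onorm[OF bl, of x] unfolding K_def by (intro mult_left_mono)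
    finally have "norm (ndmc T m n (x - P x)) \<le> coeff m n * K * norm x" by (simp add: mult.assoc)
    moreover have "ndmc T m n x - P x = ndmc T m n (x - P x) + (ndmc T m n (P x) - P x)"
      by (simp add: linear_diff linear_ndmc)
    ultimately show "norm (ndmc T m n x - P x) \<le> b n * norm x"
      using ndmc_P_diff_bound[OF P that e(1) defect, of x]
      unfolding b_def distrib_right[of "coeff m n * K"] by (metis norm_triangle_mono)
  qed
  moreover have "0 \<le> onorm (\<lambda>x. ndmc T m n x - P x)" for n
  proof (rule onorm_pos_le)
    have "bounded_linear (ndmc T m n)"
      using contraction_ndmc[of m n] linear_ndmc[of m n]
      by (intro bounded_linear_intro[where K = 1]) (auto simp: linear_add linear_scale)
    then show "bounded_linear (\<lambda>x. ndmc T m n x - P x)"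
      by (intro bounded_linear_sub bounded_linear_P)
  qed
  ultimately have "\<forall>\<^sub>F n in sequentially. norm (onorm (\<lambda>x. ndmc T m n x - P x)) \<le> b n"
    by (simp add: eventually_at_top_dense) blast
  then show "(\<lambda>n. onorm (\<lambda>x. ndmc T m n x - P x)) \<longlonglongrightarrow> 0"
    using b_lim by (rule Lim_null_comparison)
qed

end

section \<open>Limits of left decreasing projections\<close>

lemma left_decreasing_le:
  assumes "left_decreasing Q" "\<And>n. n \<ge> 1 \<Longrightarrow> projection (Q n)" "1 \<le> k" "k \<le> n"
  shows "Q n (Q k x) = Q n x"
  using assms(4)
proof (induction n rule: dec_induct)
  case base
  then show ?case using assms(2)[OF assms(3)] by (metis projection_def comp_apply)
next
  case (step n)
  have "Q (Suc n) (Q n y) = Q (Suc n) y" for y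
    using assms(1,3) step(1) unfolding left_decreasing_def
    by (metis Suc_eq_plus1 comp_apply le_trans)
  then show ?case using step.IH by metis
qed

lemma tendsto_if_onorm_diff_tendsto_0:
  assumes "\<And>n. n \<ge> 1 \<Longrightarrow> bounded_linear (Q n)" "bounded_linear P"
    and "(\<lambda>n. onorm (\<lambda>x. Q n x - P x)) \<longlonglongrightarrow> 0"
  shows "(\<lambda>n. Q n x) \<longlonglongrightarrow> P x"
proof (rule LIM_zero_cancel, rule Lim_null_comparison)
  show "(\<lambda>n. onorm (\<lambda>x. Q n x - P x) * norm x) \<longlonglongrightarrow> 0"
    by (rule tendsto_mult_left_zero[OF assms(3)])
  show "\<forall>\<^sub>F n in sequentially. norm (Q n x - P x) \<le> onorm (\<lambda>x. Q n x - P x) * norm x"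
    using assms(1,2)
    by (auto intro!: eventually_mono[OF eventually_ge_at_top[of 1]]
        onorm[where f = "\<lambda>x. Q _ x - P x"] bounded_linear_sub)
qed

lemma left_decreasing_limit:
  assumes "left_decreasing Q" "\<And>n. n \<ge> 1 \<Longrightarrow> projection (Q n)"
    and "bounded_linear P" "\<And>x. (\<lambda>n. Q n x) \<longlonglongrightarrow> P x"
  shows "k \<ge> 1 \<Longrightarrow> P (Q k x) = P x" and "P (P x) = P x"
proof -
  show PQ: "P (Q k x) = P x" if "k \<ge> 1" for k
  proof (rule LIMSEQ_unique)
    show "(\<lambda>n. Q n (Q k x)) \<longlonglongrightarrow> P (Q k x)" by (rule assms(4))
    show "(\<lambda>n. Q n (Q k x)) \<longlonglongrightarrow> P x"
      using assms(4)[of x] left_decreasing_le[OF assms(1,2) that]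
      by (auto elim!: Lim_transform_eventually
          intro!: eventually_mono[OF eventually_ge_at_top[of k]])
  qed
  have "(\<lambda>n. P (Q n x)) \<longlonglongrightarrow> P (P x)"
    by (rule bounded_linear.tendsto[OF assms(3,4)])
  moreover have "(\<lambda>n. P (Q n x)) \<longlonglongrightarrow> P x"
    by (rule tendsto_eventually)
      (use PQ in \<open>auto intro: eventually_mono[OF eventually_ge_at_top[of 1]]\<close>)
  ultimately show "P (P x) = P x" by (rule LIMSEQ_unique)
qed

section \<open>Uniform ergodicity\<close>

theorem theorem4p6:
  fixes f :: "'a::{ordered_real_vector, banach} \<Rightarrow> real"
    and T Pn :: "nat \<Rightarrow> 'a \<Rightarrow> 'a"
    and P :: "'a \<Rightarrow> 'a"
  assumes "abstract_state_space f"
    and "\<And>n. n \<ge> 1 \<Longrightarrow> markov_operator f (T n)"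
    and "\<And>n. n \<ge> 1 \<Longrightarrow> projection (Pn n)"
    and "left_decreasing Pn"
    and "\<And>n. n \<ge> 1 \<Longrightarrow> T n \<circ> Pn n = Pn n \<and> Pn n \<circ> T n = Pn n"
    and "bounded_linear P"
    and "(\<lambda>n. onorm (\<lambda>x. Pn n x - P x)) \<longlonglongrightarrow> 0"
    and "\<exists>C>0. \<forall>n\<ge>1. (\<Sum>l = 1..n - 1. dobrushin P (ndmc T l n)) \<le> C"
  shows "uniformly_ergodic T P"
proof -
  interpret abstract_state_space f by (rule assms(1))
  have bl_Pn: "bounded_linear (Pn n)" if "n \<ge> 1" for n
    using assms(3)[OF that] by (simp add: projection_def)
  have Pn_lim: "(\<lambda>n. Pn n x) \<longlonglongrightarrow> P x" for x
    by (rule tendsto_if_onorm_diff_tendsto_0[OF bl_Pn assms(6,7)])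
  have P_Pn: "P (Pn n x) = P x" if "n \<ge> 1" for n x
    by (rule left_decreasing_limit(1)[OF assms(4) _ assms(6) Pn_lim that]) (rule assms(3))
  have P_P: "P (P x) = P x" for x
    by (rule left_decreasing_limit(2)[OF assms(4) _ assms(6) Pn_lim]) (rule assms(3))
  have linear_T: "linear (T n)" if "n \<ge> 1" for n
    using assms(2)[OF that] by (simp add: markov_operator_def)
  have contr: "norm (T n x) \<le> norm x" if "n \<ge> 1" for n x
    by (rule markov_operator_contraction[OF assms(2)[OF that]])
  have T_Pn: "T n (Pn n x) = Pn n x" "Pn n (T n x) = Pn n x" if "n \<ge> 1" for n x
    using assms(5)[OF that] by (metis comp_apply)+
  interpret contraction_chain T P
  proof (rule contraction_chain.intro)
    show "P (T n x) = P x" if "n \<ge> 1" for n x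
      using P_Pn[OF that] T_Pn(2)[OF that] by metis
  qed (fact linear_T contr assms(6) P_P)+
  \<comment> \<open>\<open>Pn 0\<close> is unconstrained, and the operator norm is only known to be nonnegative from
    index \<open>1\<close> on; hence the absolute value.\<close>
  define e where "e n = 2 * \<bar>onorm (\<lambda>x. Pn n x - P x)\<bar>" for n
  have "e \<longlonglongrightarrow> 0"
    unfolding e_def by (intro tendsto_mult_right_zero tendsto_rabs_zero assms(7))
  moreover have "norm (T l (P x) - P x) \<le> e l * norm x" if "l \<ge> 1" for l x
  proof -
    have bl: "bounded_linear (\<lambda>x. Pn l x - P x)"
      using bl_Pn[OF that] assms(6) by (rule bounded_linear_sub)
    define u where "u = Pn l x - P x"
    have "T l (P x) - P x = u - T l u"
      using T_Pn(1)[OF that] linear_T[OF that] by (simp add: u_def linear_diff)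
    also have "norm \<dots> \<le> norm u + norm u"
      using norm_triangle_ineq4[of u "T l u"] contr[OF that, of u] by simp
    also have "\<dots> \<le> e l * norm x"
      using onorm[OF bl, of x] onorm_pos_le[OF bl] by (simp add: e_def u_def)
    finally show ?thesis .
  qed
  moreover have "0 \<le> e l" for l by (simp add: e_def)
  ultimately show ?thesis
    using assms(8) uniformly_ergodic_if_coeff_sum_bounded by blast
qed

end
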